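(* Let $0<\alpha<1$, let $I,J\subset\mathbb{R}$ be intervals, let $f\in C^{2}(I)$, and let $w:J\to I$ be a Hölder-continuous function of exponent $\alpha$. Let $D_x^{\alpha}$ be a linear operator acting on functions of a variable $x\in J$, with values in functions on $J$, whose domain includes all locally Hölder-continuous functions of exponent $\alpha$ on $J$. Assume that $D_x^{\alpha}$ sends constant functions to $0$ and satisfies the Leibniz rule $D_x^{\alpha}(uv)=(D_x^{\alpha}u)\,v+u\,(D_x^{\alpha}v)$ whenever $u$, $v$ and $uv$ are in its domain. Then for every $x\in J$, $$D_x^{\alpha}(f\circ w)(x)=f'(w(x))\,(D_x^{\alpha}w)(x).$$
   Context: All functions may be taken real-valued, and intervals are nondegenerate. A function $F$ on an interval $\Omega\subset\mathbb{R}$ is Hölder-continuous of exponent $\alpha$ if there is a constant $A$ such that $|F(x_1)-F(x_2)|\le A|x_1-x_2|^{\alpha}$ for all $x_1,x_2\in\Omega$. It is locally Hölder-continuous of exponent $\alpha$ on $\Omega$ if it satisfies such a condition (with a constant depending on the subinterval) on every compact interval $[a,b]\subset\Omega$. A "fractional derivative of order $\alpha$" is here any operator with the properties listed in the claim (linearity, vanishing on constants, the Leibniz rule, and a domain containing all locally Hölder-continuous functions of exponent $\alpha$). No specific formula for it is assumed. *)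

theory Defs
  imports "HOL-Analysis.Analysis"
begin

definition nondegenerate_interval :: "real set \<Rightarrow> bool" where
  "nondegenerate_interval S \<longleftrightarrow> is_interval S \<and> (\<exists>a\<in>S. \<exists>b\<in>S. a < b)"

definition hoelder_on :: "real \<Rightarrow> real set \<Rightarrow> (real \<Rightarrow> real) \<Rightarrow> bool" where
  "hoelder_on \<alpha> S F \<longleftrightarrow> (\<exists>A. \<forall>x1\<in>S. \<forall>x2\<in>S. \<bar>F x1 - F x2\<bar> \<le> A * \<bar>x1 - x2\<bar> powr \<alpha>)"

definition locally_hoelder_on :: "real \<Rightarrow> real set \<Rightarrow> (real \<Rightarrow> real) \<Rightarrow> bool" where
  "locally_hoelder_on \<alpha> S F \<longleftrightarrow> (\<forall>a b. a < b \<and> {a..b} \<subseteq> S \<longrightarrow> hoelder_on \<alpha> {a..b} F)"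

text \<open>
  Functions with domain \<open>J\<close> are represented by the elements of \<open>extensional J\<close>, so that two
  functions that agree on \<open>J\<close> are equal. \<open>Dom\<close> is the domain of the operator \<open>D\<close>; the values
  of \<open>D\<close> outside \<open>Dom\<close> are irrelevant.
\<close>

locale fractional_derivative =
  fixes \<alpha> :: real
    and J :: "real set"
    and Dom :: "(real \<Rightarrow> real) set"
    and D :: "(real \<Rightarrow> real) \<Rightarrow> (real \<Rightarrow> real)"
  assumes Dom_extensional: "Dom \<subseteq> extensional J"
    and D_extensional: "u \<in> Dom \<Longrightarrow> D u \<in> extensional J"
    and locally_hoelder_in_Dom:
      "u \<in> extensional J \<Longrightarrow> locally_hoelder_on \<alpha> J u \<Longrightarrow> u \<in> Dom"
    and add_in_Dom: "u \<in> Dom \<Longrightarrow> v \<in> Dom \<Longrightarrow> (\<lambda>x\<in>J. u x + v x) \<in> Dom"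
    and scale_in_Dom: "u \<in> Dom \<Longrightarrow> (\<lambda>x\<in>J. c * u x) \<in> Dom"
    and D_add:
      "u \<in> Dom \<Longrightarrow> v \<in> Dom \<Longrightarrow> x \<in> J \<Longrightarrow> D (\<lambda>x\<in>J. u x + v x) x = D u x + D v x"
    and D_scale: "u \<in> Dom \<Longrightarrow> x \<in> J \<Longrightarrow> D (\<lambda>x\<in>J. c * u x) x = c * D u x"
    and D_const: "x \<in> J \<Longrightarrow> D (\<lambda>x\<in>J. c) x = 0"
    and D_Leibniz:
      "u \<in> Dom \<Longrightarrow> v \<in> Dom \<Longrightarrow> (\<lambda>x\<in>J. u x * v x) \<in> Dom \<Longrightarrow> x \<in> J \<Longrightarrow>
        D (\<lambda>x\<in>J. u x * v x) x = D u x * v x + u x * D v x"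

end

theory Submission
  imports Defs
begin

text \<open>
  Fix \<open>x \<in> J\<close> and put \<open>c = w x\<close>. The slope \<open>g y = (f y - f c) / (y - c)\<close>, completed by
  \<open>g c = f' c\<close>, gives the exact factorisation \<open>f y = f c + (y - c) * g y\<close>, and therefore
  \<open>f \<circ> w = f c + (w - c) * (g \<circ> w)\<close>. The Leibniz rule turns the right-hand side into
  \<open>D (w - c) * (g \<circ> w) + (w - c) * D (g \<circ> w)\<close>. At the point \<open>x\<close> the second summand
  vanishes, whatever \<open>D (g \<circ> w)\<close> may be, and the first one is \<open>D w x * f' c\<close>, because \<open>D\<close>
  annihilates constants.

  The Leibniz rule may be used only for functions in the domain of \<open>D\<close>, and this is where the
  regularity of \<open>f\<close> enters: \<open>f\<close> being \<open>C\<^sup>2\<close>, its derivative is Lipschitz on compact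
  intervals, and the slope \<open>g\<close> inherits the Lipschitz constant of \<open>f'\<close>
  (\<open>lipschitz_on_slope\<close>). Composing a function that is Lipschitz on compact intervals with \<open>w\<close>
  gives a locally Hoelder-continuous function (\<open>locally_hoelder_on_compose\<close>).
\<close>

lemma hoelder_on_imp_continuous_on:
  assumes "hoelder_on \<alpha> S F" and "0 < \<alpha>"
  shows "continuous_on S F"
proof -
  obtain A where A: "\<And>s t. s \<in> S \<Longrightarrow> t \<in> S \<Longrightarrow> \<bar>F s - F t\<bar> \<le> A * \<bar>s - t\<bar> powr \<alpha>"
    using assms(1) unfolding hoelder_on_def by blast
  have "(F \<longlongrightarrow> F t) (at t within S)" if "t \<in> S" for t
  proof -
    have "((\<lambda>s. \<bar>s - t\<bar>) \<longlongrightarrow> 0) (at t within S)"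
      by (rule tendsto_eq_intros refl | simp)+
    then have "((\<lambda>s. \<bar>s - t\<bar> powr \<alpha>) \<longlongrightarrow> 0) (at t within S)"
      by (rule tendsto_zero_powrI[OF _ tendsto_const _ assms(2)]) simp
    then have "((\<lambda>s. A * \<bar>s - t\<bar> powr \<alpha>) \<longlongrightarrow> 0) (at t within S)"
      by (rule tendsto_mult_right_zero)
    then have "((\<lambda>s. F s - F t) \<longlongrightarrow> 0) (at t within S)"
      by (rule Lim_null_comparison[rotated])
        (use A that in \<open>auto simp: eventually_at_filter\<close>)
    then show ?thesis
      by (simp add: Lim_null[symmetric])
  qed
  then show ?thesis
    by (simp add: continuous_on_def)
qed

text \<open>
  A Lipschitz bound for \<open>h\<close> on each compact subinterval of \<open>I\<close> suffices, because \<open>w\<close> is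
  continuous and so maps a compact interval onto one.
\<close>

lemma locally_hoelder_on_compose:
  assumes "0 < \<alpha>" and "hoelder_on \<alpha> J w" and "w \<in> J \<rightarrow> I"
    and lip: "\<And>c d. c \<le> d \<Longrightarrow> {c..d} \<subseteq> I \<Longrightarrow> \<exists>L. L-lipschitz_on {c..d} h"
  shows "locally_hoelder_on \<alpha> J (compose J h w)"
  unfolding locally_hoelder_on_def
proof (intro allI impI)
  fix a b :: real assume ab: "a < b \<and> {a..b} \<subseteq> J"
  have "continuous_on {a..b} w"
    using hoelder_on_imp_continuous_on[OF assms(2,1)] ab continuous_on_subset by blast
  then obtain c d where cd: "w ` {a..b} = {c..d}" "c \<le> d"
    using continuous_image_closed_interval[of a b w] ab by auto
  have "{c..d} \<subseteq> I"
    using assms(3) ab unfolding cd(1)[symmetric] by (auto dest: funcset_mem)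
  from lip[OF cd(2) this] obtain L where L: "L-lipschitz_on {c..d} h" by blast
  obtain A where A: "\<And>s t. s \<in> J \<Longrightarrow> t \<in> J \<Longrightarrow> \<bar>w s - w t\<bar> \<le> A * \<bar>s - t\<bar> powr \<alpha>"
    using assms(2) unfolding hoelder_on_def by blast
  have "\<bar>compose J h w s - compose J h w t\<bar> \<le> (L * A) * \<bar>s - t\<bar> powr \<alpha>"
    if st: "s \<in> {a..b}" "t \<in> {a..b}" for s t
  proof -
    have J: "s \<in> J" "t \<in> J" and K: "w s \<in> {c..d}" "w t \<in> {c..d}"
      using st ab cd(1) by blast+
    have "\<bar>h (w s) - h (w t)\<bar> \<le> L * \<bar>w s - w t\<bar>"
      using lipschitz_onD[OF L K] by (simp add: dist_real_def)
    also have "\<dots> \<le> L * (A * \<bar>s - t\<bar> powr \<alpha>)"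
      using A[OF J] lipschitz_on_nonneg[OF L] by (rule mult_left_mono)
    finally show ?thesis
      using J by (simp add: compose_eq mult.assoc)
  qed
  then show "hoelder_on \<alpha> {a..b} (compose J h w)"
    unfolding hoelder_on_def by blast
qed

lemma C1_imp_lipschitz_on_closed_interval:
  fixes h h' :: "real \<Rightarrow> real"
  assumes deriv: "\<And>y. y \<in> {c..d} \<Longrightarrow> (h has_real_derivative h' y) (at y within {c..d})"
    and "continuous_on {c..d} h'"
  shows "\<exists>L. L-lipschitz_on {c..d} h"
proof -
  have "bounded (h' ` {c..d})"
    using assms(2) compact_continuous_image compact_imp_bounded by blast
  then obtain B where B: "B > 0" "\<And>y. y \<in> {c..d} \<Longrightarrow> norm (h' y) \<le> B"
    unfolding bounded_pos by blast
  have "B-lipschitz_on {c..d} h"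
    using field_differentiable_bound[OF _ deriv B(2)] B(1)
    by (intro lipschitz_onI) (auto simp: dist_norm)
  then show ?thesis by blast
qed

definition slope_at :: "(real \<Rightarrow> real) \<Rightarrow> (real \<Rightarrow> real) \<Rightarrow> real \<Rightarrow> real \<Rightarrow> real" where
  "slope_at f f' c y = (if y = c then f' c else (f y - f c) / (y - c))"

text \<open>
  The slope is the mean of \<open>f'\<close> over the segment from \<open>c\<close> to \<open>y\<close>, that is, the integral of
  \<open>f' (c + t * (y - c))\<close> over \<open>t \<in> {0..1}\<close>. Moving \<open>y\<close> to \<open>z\<close> changes the integrand by at
  most \<open>L * \<bar>y - z\<bar>\<close>. The proof works with antiderivatives in \<open>t\<close> of the two integrands
  and applies the mean value inequality to their difference.
\<close>

lemma lipschitz_on_slope: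
  assumes "convex K" and "c \<in> K"
    and deriv: "\<And>y. y \<in> K \<Longrightarrow> (f has_real_derivative f' y) (at y within K)"
    and lip: "L-lipschitz_on K f'"
  shows "L-lipschitz_on K (slope_at f f' c)"
proof (rule lipschitz_onI)
  define F where "F y t = (if y = c then t * f' c else f (c + t * (y - c)) / (y - c))" for y t
  have seg: "c + t * (y - c) \<in> K" if "y \<in> K" "t \<in> {0..1}" for y t
    using convexD_alt[OF assms(1,2) that(1), of t] that(2) by (simp add: algebra_simps)
  have dF: "(F y has_real_derivative f' (c + t * (y - c))) (at t within {0..1})"
    if y: "y \<in> K" and t: "t \<in> {0..1}" for y t
  proof (cases "y = c")
    case True
    then show ?thesis
      unfolding F_def by (auto intro!: derivative_eq_intros)
  next
    case False
    have "((\<lambda>t. c + t * (y - c)) has_real_derivative (y - c)) (at t within {0..1})"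
      by (auto intro!: derivative_eq_intros)
    moreover have "(f has_real_derivative f' (c + t * (y - c)))
        (at (c + t * (y - c)) within (\<lambda>t. c + t * (y - c)) ` {0..1})"
      using deriv[OF seg[OF y t]] by (rule DERIV_subset) (use seg[OF y] in auto)
    ultimately have "((\<lambda>t. f (c + t * (y - c))) has_real_derivative
        f' (c + t * (y - c)) * (y - c)) (at t within {0..1})"
      using DERIV_image_chain by (fastforce simp: o_def)
    from DERIV_cdivide[OF this, of "y - c"] show ?thesis
      using False by (simp add: F_def[abs_def])
  qed
  have F_slope: "F y 1 - F y 0 = slope_at f f' c y" for y
    by (simp add: F_def slope_at_def diff_divide_distrib)
  fix y z assume yz: "y \<in> K" "z \<in> K"
  have "norm ((F y 1 - F z 1) - (F y 0 - F z 0)) \<le> L * \<bar>y - z\<bar> * norm (1 - 0 :: real)"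
  proof (rule field_differentiable_bound[where S = "{0..1}"])
    fix t :: real assume t: "t \<in> {0..1}"
    show "((\<lambda>t. F y t - F z t) has_real_derivative
        f' (c + t * (y - c)) - f' (c + t * (z - c))) (at t within {0..1})"
      by (intro DERIV_diff dF yz t)
    have "norm (f' (c + t * (y - c)) - f' (c + t * (z - c)))
        \<le> L * \<bar>(c + t * (y - c)) - (c + t * (z - c))\<bar>"
      using lipschitz_onD[OF lip seg[OF yz(1) t] seg[OF yz(2) t]] by (simp add: dist_real_def)
    also have "(c + t * (y - c)) - (c + t * (z - c)) = t * (y - z)"
      by (simp add: algebra_simps)
    also have "L * \<bar>t * (y - z)\<bar> \<le> L * \<bar>y - z\<bar>"
      using t lipschitz_on_nonneg[OF lip]
      by (intro mult_left_mono) (auto simp: abs_mult intro: mult_left_le_one_le)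
    finally show "norm (f' (c + t * (y - c)) - f' (c + t * (z - c))) \<le> L * \<bar>y - z\<bar>" .
  qed auto
  moreover have "(F y 1 - F z 1) - (F y 0 - F z 0) = slope_at f f' c y - slope_at f f' c z"
    using F_slope[of y] F_slope[of z] by linarith
  ultimately show "dist (slope_at f f' c y) (slope_at f f' c z) \<le> L * dist y z"
    by (simp add: dist_real_def)
qed (rule lipschitz_on_nonneg[OF lip])

theorem theorem2:
  fixes \<alpha> :: real
    and I J :: "real set"
    and f f' f'' w :: "real \<Rightarrow> real"
    and Dom :: "(real \<Rightarrow> real) set"
    and D :: "(real \<Rightarrow> real) \<Rightarrow> (real \<Rightarrow> real)"
  assumes "0 < \<alpha>" and "\<alpha> < 1"
    and "nondegenerate_interval I" and "nondegenerate_interval J"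
    and "\<And>y. y \<in> I \<Longrightarrow> (f has_real_derivative f' y) (at y within I)"
    and "\<And>y. y \<in> I \<Longrightarrow> (f' has_real_derivative f'' y) (at y within I)"
    and "continuous_on I f''"
    and "w \<in> J \<rightarrow>\<^sub>E I"
    and "hoelder_on \<alpha> J w"
    and "fractional_derivative \<alpha> J Dom D"
    and "x \<in> J"
  shows "D (compose J f w) x = f' (w x) * D w x"
proof -
  interpret fractional_derivative \<alpha> J Dom D by fact
  define c where "c = w x"
  define g where "g = slope_at f f' c"
  have w: "w \<in> J \<rightarrow> I" and w_ext: "w \<in> extensional J"
    using assms(8) by (auto simp: PiE_def)
  have c: "c \<in> I"
    using w assms(11) by (auto simp: c_def)
  have deriv_f: "(f has_real_derivative f' y) (at y within {a..b})"
    and deriv_f': "(f' has_real_derivative f'' y) (at y within {a..b})"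
    if "{a..b} \<subseteq> I" "y \<in> {a..b}" for a b y
    using that assms(5,6) DERIV_subset by blast+
  have lip_f': "\<exists>L. L-lipschitz_on {a..b} f'" if "{a..b} \<subseteq> I" for a b
    using deriv_f'[OF that] continuous_on_subset[OF assms(7) that]
    by (rule C1_imp_lipschitz_on_closed_interval)
  have lip_f: "\<exists>L. L-lipschitz_on {a..b} f" if "{a..b} \<subseteq> I" for a b
  proof (rule C1_imp_lipschitz_on_closed_interval[OF deriv_f[OF that]])
    show "continuous_on {a..b} f'"
      using deriv_f'[OF that] by (rule DERIV_continuous_on)
  qed
  have lip_g: "\<exists>L. L-lipschitz_on {a..b} g" if ab: "a \<le> b" "{a..b} \<subseteq> I" for a b
  proof -
    \<comment> \<open>The slope compares with the base point, so the interval must be enlarged to contain it.\<close>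
    let ?K = "{min a c..max b c}"
    have "min a c \<in> I" "max b c \<in> I"
      using ab c by (auto simp: min_def max_def)
    then have K: "?K \<subseteq> I"
      using assms(3) unfolding nondegenerate_interval_def is_interval_1
      by (meson atLeastAtMost_iff subsetI)
    obtain L where "L-lipschitz_on ?K f'"
      using lip_f'[OF K] by blast
    then have "L-lipschitz_on ?K g"
      unfolding g_def using deriv_f[OF K] by (intro lipschitz_on_slope) auto
    then show ?thesis
      by (meson lipschitz_on_subset atLeastatMost_subset_iff min.cobounded1 max.cobounded1)
  qed
  have in_Dom: "compose J h w \<in> Dom"
    if "\<And>a b. a \<le> b \<Longrightarrow> {a..b} \<subseteq> I \<Longrightarrow> \<exists>L. L-lipschitz_on {a..b} h" for h
    using locally_hoelder_on_compose[OF assms(1,9) w that]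
    by (intro locally_hoelder_in_Dom) auto
  define u where "u = compose J (\<lambda>y. y - c) w"
  define v where "v = compose J g w"
  define p where "p = compose J (\<lambda>y. f y - f c) w"
  have u: "u \<in> Dom"
    unfolding u_def
    using lipschitz_on_diff[OF lipschitz_on_id lipschitz_on_constant] by (intro in_Dom) blast
  have v: "v \<in> Dom"
    unfolding v_def by (intro in_Dom lip_g)
  have p: "p \<in> Dom"
    unfolding p_def
  proof (rule in_Dom)
    fix a b :: real assume "{a..b} \<subseteq> I"
    then obtain L where "L-lipschitz_on {a..b} f" using lip_f by blast
    then show "\<exists>L. L-lipschitz_on {a..b} (\<lambda>y. f y - f c)"
      using lipschitz_on_diff lipschitz_on_constant by blast
  qed
  have const: "(\<lambda>s\<in>J. k) \<in> Dom" for k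
    using in_Dom[of "\<lambda>_. k"] lipschitz_on_constant unfolding compose_def by blast
  have D_add_const: "D (\<lambda>s\<in>J. q s + k) x = D q x" if "q \<in> Dom" for q k
  proof -
    have "(\<lambda>s\<in>J. q s + k) = (\<lambda>s\<in>J. q s + (\<lambda>s\<in>J. k) s)"
      by (auto simp: restrict_def)
    then show ?thesis
      using D_add[OF that const assms(11)] D_const[OF assms(11)] by simp
  qed
  have p_eq: "p = (\<lambda>s\<in>J. u s * v s)"
    by (auto simp: p_def u_def v_def g_def compose_def restrict_def slope_at_def)
  have w_eq: "w = (\<lambda>s\<in>J. u s + c)"
    using w_ext by (auto simp: u_def compose_def restrict_def extensional_def)
  have fw_eq: "compose J f w = (\<lambda>s\<in>J. p s + f c)"
    by (auto simp: p_def compose_def restrict_def)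
  have "D (compose J f w) x = D (\<lambda>s\<in>J. u s * v s) x"
    unfolding fw_eq D_add_const[OF p] by (simp only: p_eq)
  also have "\<dots> = D u x * v x + u x * D v x"
    using D_Leibniz[OF u v _ assms(11)] p p_eq by simp
  also have "\<dots> = f' (w x) * D u x"
    using assms(11) by (simp add: u_def v_def compose_eq g_def slope_at_def c_def)
  also have "D u x = D w x"
    using D_add_const[OF u, of c] w_eq by simp
  finally show ?thesis .
qed

end
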